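(* Let $n\in\mathbb{N}$ and let $f:\mathbb{C}\to\mathbb{P}^n(\mathbb{C})$ be a holomorphic curve with $$\limsup_{r\to\infty}\frac{\log^+\log^+T_f(r)}{\log\log r}<1.$$ Then there exists a reduced representation $\mathbf{f}=(f_0,\dots,f_n)$ of $f$ such that $\sigma_2^{\log}(f_i)<1$ for every $i=0,\dots,n$.
   Context: A reduced representation of $f$ is a tuple $(f_0,\dots,f_n)$ of entire functions without common zeros with $f=[f_0:\dots:f_n]$. The characteristic function of $f$ is $T_f(r)=\int_0^{2\pi}\log\|\mathbf{f}(re^{i\theta})\|\frac{d\theta}{2\pi}$ with $\|\mathbf{f}(z)\|=\max_k|f_k(z)|$ (independent of the reduced representation up to $O(1)$). For a meromorphic function $g$, $\sigma_2^{\log}(g)=\limsup_{r\to\infty}\frac{\log^+\log^+T(r,g)}{\log\log r}$, where $T(r,g)$ is the Nevanlinna characteristic. *)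

theory Defs
  imports "HOL-Analysis.Analysis"
begin

definition logp :: "real \<Rightarrow> real" where
  "logp x = (if x \<le> 1 then 0 else ln x)"

definition reduced_rep :: "nat \<Rightarrow> (nat \<Rightarrow> complex \<Rightarrow> complex) \<Rightarrow> bool" where
  "reduced_rep n F \<longleftrightarrow> (\<forall>i\<le>n. F i holomorphic_on UNIV) \<and> (\<forall>z. \<exists>i\<le>n. F i z \<noteq> 0)"

definition same_curve :: "nat \<Rightarrow> (nat \<Rightarrow> complex \<Rightarrow> complex) \<Rightarrow> (nat \<Rightarrow> complex \<Rightarrow> complex) \<Rightarrow> bool" where
  "same_curve n G F \<longleftrightarrow> (\<forall>z. \<exists>c. c \<noteq> 0 \<and> (\<forall>i\<le>n. G i z = c * F i z))"

definition curve_norm :: "nat \<Rightarrow> (nat \<Rightarrow> complex \<Rightarrow> complex) \<Rightarrow> complex \<Rightarrow> real" where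
  "curve_norm n F z = Max ((\<lambda>i. cmod (F i z)) ` {0..n})"

definition char_curve :: "nat \<Rightarrow> (nat \<Rightarrow> complex \<Rightarrow> complex) \<Rightarrow> real \<Rightarrow> real" where
  "char_curve n F r =
     integral {0..2*pi} (\<lambda>t. ln (curve_norm n F (of_real r * cis t))) / (2*pi)"

text \<open>Nevanlinna characteristic T(r,g) = m(r,g) + N(r,g) of an entire function g.
  Since g has no poles, N(r,g) = 0 and T(r,g) = m(r,g) = int_0^{2pi} log^+|g(re^{i theta})| dtheta/(2pi).\<close>
definition nev_char_entire :: "(complex \<Rightarrow> complex) \<Rightarrow> real \<Rightarrow> real" where
  "nev_char_entire g r = integral {0..2*pi} (\<lambda>t. logp (cmod (g (of_real r * cis t)))) / (2*pi)"

definition sigma2_log :: "(complex \<Rightarrow> complex) \<Rightarrow> ereal" where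
  "sigma2_log g = Limsup at_top (\<lambda>r. ereal (logp (logp (nev_char_entire g r)) / ln (ln r)))"

end

theory Submission
  imports Defs "HOL-Complex_Analysis.Complex_Analysis" "HOL-Real_Asymp.Real_Asymp"
begin

text \<open>
  The growth assumption makes the curve of order zero. Choose a coordinate f of the given
  representation with f(0) nonzero, and let b(k) be the inverses of its zeros. Jensen's inequality
  bounds the sum of log^+ (r |b(k)|) by T(r) + O(1), where T is the characteristic of the curve.
  Hence the genus zero product P of the factors 1 - b(k) z converges, and
  log |P(z)| is at most T(r^4) + O(1) on the circle of radius r. The quotient H = f/P is entire
  without zeros, and dividing the representation by H gives the required G. On the circle of
  radius r one has log^+ |G(i)| \<le> log ||F|| - log |f| + T(r^4) + O(1) pointwise; integrating, and
  using Jensen once more for the term log |f|, gives T(r, G(i)) \<le> T(r) + T(r^4) + O(1).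
\<close>

section \<open>Truncated logarithm and circle means of log-moduli\<close>

lemma logp_nonneg: "0 \<le> logp x"
  by (simp add: logp_def)

lemma logp_eq_ln_max: "logp x = ln (max 1 x)"
  by (auto simp: logp_def max_def)

lemma logp_mono: "x \<le> y \<Longrightarrow> logp x \<le> logp y"
  by (auto simp: logp_eq_ln_max)

lemma continuous_on_logp [continuous_intros]:
  "continuous_on S f \<Longrightarrow> continuous_on S (\<lambda>x. logp (f x))"
  unfolding logp_eq_ln_max by (intro continuous_intros) auto

text \<open>A zero-free \<open>g\<close> on the disc has a holomorphic logarithm \<open>h\<close>,
  and ln |g| is the real part of \<open>h\<close>. Cauchy's integral formula then gives the mean
  value at the centre.\<close>

lemma has_integral_ln_cmod_nonvanishing:
  assumes "g holomorphic_on ball 0 R" "\<And>z. z \<in> ball 0 R \<Longrightarrow> g z \<noteq> 0" "0 < r" "r < R"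
  shows "((\<lambda>t. ln (cmod (g (of_real r * cis t)))) has_integral 2 * pi * ln (cmod (g 0))) {0..2*pi}"
proof -
  have "0 \<in> ball (0::complex) R" using assms by simp
  then obtain h where h: "h holomorphic_on ball 0 R" and eh: "\<And>z. z \<in> ball 0 R \<Longrightarrow> exp (h z) = g z"
    using holomorphic_logarithm_exists[OF convex_ball open_ball assms(1,2)] by metis
  have "h holomorphic_on cball 0 r"
    using h by (rule holomorphic_on_subset) (use assms in auto)
  from Cauchy_integral_circlepath_simple[OF this, of 0] assms
  have "((\<lambda>u. h u / u) has_contour_integral (2 * of_real pi * \<i> * h 0)) (circlepath 0 r)"
    by simp
  then have "((\<lambda>t. h (of_real r * cis t) / (of_real r * cis t) * r * \<i> * cis t) has_integral 2 * of_real pi * \<i> * h 0) {0..2*pi}"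
    by (simp add: circlepath_def has_contour_integral_part_circlepath_iff)
  then have "((\<lambda>t. \<i> * h (of_real r * cis t)) has_integral 2 * of_real pi * \<i> * h 0) {0..2*pi}"
    by (rule has_integral_eq[rotated]) (use assms in auto)
  \<comment> \<open>The parametrised Cauchy integrand is \<open>\<i> * h\<close>, whose imaginary
    part is the real part of \<open>h\<close>.\<close>
  from has_integral_linear[OF this bounded_linear_Im]
  have "((\<lambda>t. Re (h (of_real r * cis t))) has_integral 2 * pi * Re (h 0)) {0..2*pi}"
    by (simp add: o_def)
  moreover have "ln (cmod (g z)) = Re (h z)" if "z \<in> ball 0 R" for z
    unfolding eh[OF that, symmetric] by simp
  moreover have "of_real r * cis t \<in> ball 0 R" for t using assms by (simp add: norm_mult)
  ultimately show ?thesis using \<open>0 \<in> ball 0 R\<close> by (simp only:)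
qed

text \<open>Jensen's formula for one linear factor. If the zero 1/b lies outside the circle (or
  \<open>b = 0\<close>), the factor is zero-free on a larger disc. If it lies inside, reflection in
  the circle leads to a zero-free factor at the cost of the constant ln (r |b|).\<close>

lemma has_integral_ln_cmod_linear:
  fixes b :: complex
  assumes r: "0 < r" and nb: "r * cmod b \<noteq> 1"
  shows "((\<lambda>t. ln (cmod (1 - b * (of_real r * cis t)))) has_integral 2 * pi * logp (r * cmod b)) {0..2*pi}"
proof (cases "r * cmod b < 1")
  case True
  obtain R where R: "r < R" "R * cmod b < 1"
  proof (cases "b = 0")
    case False
    then have "r < 1 / cmod b" using True by (simp add: field_simps)
    then obtain R where "r < R" "R < 1 / cmod b" using dense by blast
    then show ?thesis using that False by (simp add: field_simps)
  qed (use that[of "r+1"] in auto)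
  have "1 - b * z \<noteq> 0" if "z \<in> ball 0 R" for z
  proof
    assume "1 - b * z = 0"
    then have "cmod (b * z) = 1" by (metis norm_one right_minus_eq)
    moreover have "cmod z * cmod b \<le> R * cmod b" using that by (intro mult_right_mono) auto
    ultimately show False using R by (simp add: norm_mult mult.commute)
  qed
  from has_integral_ln_cmod_nonvanishing[where g = "\<lambda>z. 1 - b * z", OF _ this r R(1)]
  have "((\<lambda>t. ln (cmod (1 - b * (of_real r * cis t)))) has_integral 2 * pi * ln (cmod (1 - b * 0))) {0..2*pi}"
    by (simp add: holomorphic_intros)
  then show ?thesis using True by (simp add: logp_def)
next
  case False
  \<comment> \<open>After scaling to the unit circle the zero is 1/(b r). The factor
    \<open>1 - c * z\<close> has its zero at the reflected point cnj (b r), outside the unit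
    disc.\<close>
  define c where "c = 1 / cnj (b * of_real r)"
  have gt: "r * cmod b > 1" and b0: "b \<noteq> 0" using False nb by auto
  have c: "cmod c < 1" using gt r by (simp add: c_def norm_mult norm_divide field_simps)
  obtain R where R: "1 < R" "R * cmod c < 1"
  proof -
    have "c \<noteq> 0" using b0 r by (simp add: c_def)
    then have "1 < 1 / cmod c" using c by (simp add: field_simps)
    then obtain R where "1 < R" "R < 1 / cmod c" using dense by blast
    then show ?thesis using that \<open>c \<noteq> 0\<close> by (simp add: field_simps)
  qed
  have "1 - c * z \<noteq> 0" if "z \<in> ball 0 R" for z
  proof
    assume "1 - c * z = 0"
    then have "cmod (c * z) = 1" by (metis norm_one right_minus_eq)
    moreover have "cmod z * cmod c \<le> R * cmod c" using that by (intro mult_right_mono) auto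
    ultimately show False using R by (simp add: norm_mult mult.commute)
  qed
  from has_integral_ln_cmod_nonvanishing[where g = "\<lambda>z. 1 - c * z", OF _ this zero_less_one R(1)]
  have "((\<lambda>t. ln (cmod (1 - c * (of_real 1 * cis t)))) has_integral 2 * pi * ln (cmod (1 - c * 0))) {0..2*pi}"
    by (simp add: holomorphic_intros)
  then have "((\<lambda>t. ln (cmod (1 - c * cis t))) has_integral 0) {0..2*pi}" by simp
  from has_integral_add[OF has_integral_const_real[of "ln (r * cmod b)" 0 "2*pi"] this]
  have "((\<lambda>t. ln (r * cmod b) + ln (cmod (1 - c * cis t))) has_integral 2 * pi * logp (r * cmod b)) {0..2*pi}"
    using gt by (simp add: logp_def)
  moreover have "ln (r * cmod b) + ln (cmod (1 - c * cis t)) = ln (cmod (1 - b * (of_real r * cis t)))" for t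
  proof -
    have "cmod (1 - c * cis t) = cmod (cnj (1 - c * cis t))" by (rule complex_mod_cnj[symmetric])
    also have "cnj (1 - c * cis t) = 1 - cis (-t) / (b * of_real r)"
      by (simp add: c_def cis_cnj)
    also have "\<dots> = - cis (-t) / (b * of_real r) * (1 - b * (of_real r * cis t))"
      using b0 r by (simp add: field_simps cis_mult)
    finally have eq: "cmod (1 - c * cis t) = cmod (1 - b * (of_real r * cis t)) / (r * cmod b)"
      using r by (simp add: norm_mult norm_divide mult.commute)
    have "1 - b * (of_real r * cis t) \<noteq> 0"
    proof
      assume "1 - b * (of_real r * cis t) = 0"
      then have "cmod (b * (of_real r * cis t)) = 1" by (metis norm_one right_minus_eq)
      then show False using nb r by (simp add: norm_mult mult.commute)
    qed
    then show ?thesis unfolding eq using r b0 by (simp add: ln_div)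
  qed
  ultimately show ?thesis by simp
qed

section \<open>Dividing out the zeros of an entire function in order of modulus\<close>

text \<open>The zero set is closed, so some zero \<open>a\<close> is nearest to 0, and b = 1/a. If
  there is no zero, \<open>b = 0\<close> and \<open>h = g\<close>. The clause
  \<open>1 \<le> cmod (b * z)\<close> covers both cases: it expresses minimality of |a|, and for
  \<open>b = 0\<close> the absence of zeros.\<close>

lemma entire_divide_smallest_zero:
  assumes g: "g holomorphic_on UNIV" and g0: "g 0 \<noteq> (0::complex)"
  shows "\<exists>h b. h holomorphic_on UNIV \<and> h 0 = g 0 \<and> (\<forall>z. g z = (1 - b * z) * h z) \<and>
    (\<forall>z. g z = 0 \<longrightarrow> 1 \<le> cmod (b * z)) \<and> (b = 0 \<or> g (1 / b) = 0)"
proof (cases "\<exists>z. g z = 0")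
  case False
  then show ?thesis using g by (intro exI[of _ g] exI[of _ 0]) auto
next
  case True
  have "closed {z. g z = 0}"
    using g by (intro closed_Collect_eq continuous_on_const holomorphic_on_imp_continuous_on)
  with True obtain a where a: "g a = 0" and min: "\<And>z. g z = 0 \<Longrightarrow> cmod a \<le> cmod z"
    using distance_attains_inf[of "{z. g z = 0}" 0] by auto
  have a0: "a \<noteq> 0" using a g0 by auto
  \<comment> \<open>The difference quotient has a removable singularity at \<open>a\<close>. The
    factor \<open>-a\<close> turns z - a into the normalised 1 - z/a, which keeps the value at
    0.\<close>
  define h where "h z = -a * (if z = a then deriv g a else (g z - g a) / (z - a))" for z
  have "h holomorphic_on UNIV"
    unfolding h_def by (intro holomorphic_intros pole_lemma_open g open_UNIV)
  moreover have "h 0 = g 0" using a a0 by (simp add: h_def)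
  moreover have "g z = (1 - 1 / a * z) * h z" for z
    using a a0 by (auto simp: h_def divide_simps) (auto simp: algebra_simps)
  moreover have "1 \<le> cmod (1 / a * z)" if "g z = 0" for z
    using min[OF that] a0 by (simp add: norm_divide)
  ultimately show ?thesis using a by (intro exI[of _ h] exI[of _ "1/a"]) auto
qed

text \<open>
  Here g n is f with its n zeros of smallest modulus divided out, and b n is the inverse of the
  next zero, with b n = 0 once no zero is left.
\<close>

definition successive_zeros ::
    "(complex \<Rightarrow> complex) \<Rightarrow> (nat \<Rightarrow> complex) \<Rightarrow> (nat \<Rightarrow> complex \<Rightarrow> complex) \<Rightarrow> bool" where
  "successive_zeros f b g \<longleftrightarrow>
    (\<forall>n. g n holomorphic_on UNIV \<and> g n 0 = f 0) \<and> g 0 = f \<and> f 0 \<noteq> 0 \<and>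
    (\<forall>n z. g n z = (1 - b n * z) * g (Suc n) z) \<and>
    (\<forall>n z. g n z = 0 \<longrightarrow> 1 \<le> cmod (b n * z)) \<and>
    decseq (\<lambda>n. cmod (b n)) \<and> b \<longlonglongrightarrow> 0"

text \<open>Dependent choice iterates the division. If the inverses did not tend to 0, monotonicity
  would keep them all at modulus at least some c > 0. On a fixed large circle every division then at
  least halves the bound, although the value at 0 stays f(0), so f(0) would be 0.\<close>

lemma entire_successive_zeros:
  assumes f: "f holomorphic_on UNIV" and f0: "f 0 \<noteq> (0::complex)"
  obtains b g where "successive_zeros f b g"
proof -
  define P where "P g \<longleftrightarrow> g holomorphic_on UNIV \<and> g 0 = f 0" for g
  define Q where "Q g h b \<longleftrightarrow> (\<forall>z. g z = (1 - b * z) * h z) \<and> (\<forall>z. g z = 0 \<longrightarrow> 1 \<le> cmod (b * z)) \<and>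
      (b = 0 \<or> g (1 / b) = 0)" for g h :: "complex \<Rightarrow> complex" and b
  have step: "\<exists>h. P h \<and> (\<exists>b. Q g h b)" if "P g" for g
  proof -
    have g: "g holomorphic_on UNIV" "g 0 = f 0" using that by (simp_all add: P_def)
    have "g 0 \<noteq> 0" using g f0 by simp
    obtain h b where h: "h holomorphic_on UNIV" "h 0 = g 0" and bh: "\<forall>z. g z = (1 - b * z) * h z"
      "\<forall>z. g z = 0 \<longrightarrow> 1 \<le> cmod (b * z)" "b = 0 \<or> g (1 / b) = 0"
      using entire_divide_smallest_zero[OF g(1) \<open>g 0 \<noteq> 0\<close>] by (elim exE conjE)
    have "P h" using h g unfolding P_def by simp
    moreover have "Q g h b" unfolding Q_def using bh by blast
    ultimately show ?thesis by blast
  qed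
  \<comment> \<open>The recursion runs over the functions alone. The inverse zeros stay existential
    here and are selected afterwards by ordinary choice.\<close>
  have "\<exists>g. \<forall>n. (P (g n) \<and> (n = 0 \<longrightarrow> g n = f)) \<and> (\<exists>b. Q (g n) (g (Suc n)) b)"
  proof (rule dependent_nat_choice)
    show "\<exists>g. P g \<and> ((0::nat) = 0 \<longrightarrow> g = f)" using f by (auto simp: P_def)
  qed (use step in auto)
  then obtain g where g_all: "\<forall>n. (P (g n) \<and> (n = 0 \<longrightarrow> g n = f)) \<and> (\<exists>b. Q (g n) (g (Suc n)) b)" ..
  have g: "P (g n)" "\<exists>b. Q (g n) (g (Suc n)) b" for n using spec[OF g_all, of n] by blast+
  have "g 0 = f" using spec[OF g_all, of 0] by blast
  from g(2) have "\<forall>n. \<exists>b. Q (g n) (g (Suc n)) b" ..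
  from choice[OF this] obtain b where b: "\<And>n. Q (g n) (g (Suc n)) (b n)" by blast
  have eq: "g n z = (1 - b n * z) * g (Suc n) z" for n z using b[of n] unfolding Q_def by blast
  have zero: "1 \<le> cmod (b n * z)" if "g n z = 0" for n z using b[of n] that unfolding Q_def by blast
  have hol: "g n holomorphic_on UNIV" and g0: "g n 0 = f 0" for n using g(1)[of n] by (simp_all add: P_def)
  have dec: "decseq (\<lambda>n. cmod (b n))"
  proof (rule decseq_SucI)
    fix n
    show "cmod (b (Suc n)) \<le> cmod (b n)"
    proof (cases "b (Suc n) = 0")
      case False
      then have "g (Suc n) (1 / b (Suc n)) = 0" using b[of "Suc n"] unfolding Q_def by blast
      \<comment> \<open>A zero of the quotient is already a zero of \<open>g n\<close>, so
        minimality at stage n compares the two moduli.\<close>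
      then have "g n (1 / b (Suc n)) = 0" by (subst eq) simp
      from zero[OF this] show ?thesis using False by (simp add: norm_divide norm_mult field_simps)
    qed simp
  qed
  have "b \<longlonglongrightarrow> 0"
  proof (rule ccontr)
    assume "\<not> b \<longlonglongrightarrow> 0"
    then obtain c where c: "c > 0" "\<forall>N. \<exists>n\<ge>N. c \<le> cmod (b n)"
      unfolding LIMSEQ_def by (auto simp: not_less)
    have bc: "c \<le> cmod (b n)" for n
      using c(2) decseqD[OF dec] by (meson order_trans)
    \<comment> \<open>On this circle |b n z| is at least 3, hence every factor 1 - b n z has modulus
      at least 2.\<close>
    define R where "R = 3 / c"
    have R: "R > 0" using c by (simp add: R_def)
    have "bounded (f ` sphere 0 R)"
      using holomorphic_on_subset[OF f]
      by (intro compact_imp_bounded compact_continuous_image holomorphic_on_imp_continuous_on) auto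
    then obtain M where "\<forall>w\<in>f ` sphere 0 R. cmod w \<le> M"
      unfolding bounded_iff ..
    then have M: "cmod (f z) \<le> M" if "cmod z = R" for z using that by simp
    have bd: "cmod (g n z) \<le> M / 2 ^ n" if "cmod z = R" for n z
    proof (induction n)
      case 0
      then show ?case using M that \<open>g 0 = f\<close> by simp
    next
      case (Suc n)
      have "c * cmod z \<le> cmod (b n) * cmod z" using bc by (intro mult_right_mono) auto
      then have "3 \<le> cmod (b n) * cmod z" using that c by (simp add: R_def)
      then have "2 \<le> cmod (1 - b n * z)"
        using norm_triangle_ineq3[of 1 "b n * z"] by (simp add: norm_mult)
      then have "2 * cmod (g (Suc n) z) \<le> cmod (1 - b n * z) * cmod (g (Suc n) z)"
        by (intro mult_right_mono) auto
      also have "\<dots> = cmod (g n z)" by (subst (2) eq) (simp add: norm_mult)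
      also have "\<dots> \<le> M / 2 ^ n" by (rule Suc)
      finally show ?case by (simp add: field_simps)
    qed
    have "cmod (f 0) \<le> M / 2 ^ n" for n
    proof -
      \<comment> \<open>Cauchy's inequality for the derivative of order 0 serves as the maximum
        principle at the centre.\<close>
      have "cmod ((deriv ^^ 0) (g n) 0) \<le> fact 0 * (M / 2 ^ n) / R ^ 0"
      proof (rule Cauchy_inequality[OF _ _ R])
        show "g n holomorphic_on ball 0 R" by (rule holomorphic_on_subset[OF hol]) simp
        show "continuous_on (cball 0 R) (g n)"
          by (rule holomorphic_on_imp_continuous_on, rule holomorphic_on_subset[OF hol]) simp
      qed (simp add: bd)
      then show ?thesis by (simp add: g0)
    qed
    moreover have "(\<lambda>n. M / 2 ^ n) \<longlonglongrightarrow> 0"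
      using tendsto_mult_right_zero[OF LIMSEQ_power_zero[of "1/2::real"], of M]
      by (simp add: power_divide)
    ultimately have "cmod (f 0) \<le> 0" using LIMSEQ_le_const by blast
    then show False using f0 by simp
  qed
  have "successive_zeros f b g"
    unfolding successive_zeros_def using hol \<open>g 0 = f\<close> g0 f0 eq zero dec \<open>b \<longlonglongrightarrow> 0\<close> by blast
  then show ?thesis by (rule that)
qed

section \<open>Finite factorisation and Jensen's inequality\<close>

context
  fixes f :: "complex \<Rightarrow> complex" and b :: "nat \<Rightarrow> complex" and g :: "nat \<Rightarrow> complex \<Rightarrow> complex"
  assumes zeros: "successive_zeros f b g"
begin

private lemma
  shows g_hol: "g n holomorphic_on UNIV" and g_0: "g 0 = f" and g_at_0: "g n 0 = f 0"
    and f0: "f 0 \<noteq> 0" and g_step: "g n z = (1 - b n * z) * g (Suc n) z"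
    and g_zero: "g n z = 0 \<Longrightarrow> 1 \<le> cmod (b n * z)"
    and dec: "decseq (\<lambda>n. cmod (b n))" and b_lim: "b \<longlonglongrightarrow> 0"
  using zeros unfolding successive_zeros_def by blast+

private lemma factor: "f z = (\<Prod>k<n. 1 - b k * z) * g n z"
proof (induction n)
  case (Suc n)
  then show ?case by (simp add: g_step[of n z] mult.assoc)
qed (simp add: g_0)

private lemma ex_small: "\<exists>N\<ge>n. \<forall>k\<ge>N. r * cmod (b k) < 1"
proof -
  have "(\<lambda>k. r * cmod (b k)) \<longlonglongrightarrow> r * 0"
    using b_lim by (intro tendsto_mult_left) (simp add: tendsto_norm_zero)
  then have "\<forall>\<^sub>F k in sequentially. r * cmod (b k) < 1"
    by (intro order_tendstoD(2)) auto
  then obtain N where "\<forall>k\<ge>N. r * cmod (b k) < 1" by (auto simp: eventually_sequentially)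
  then show ?thesis by (intro exI[of _ "max n N"]) auto
qed

private lemma linear_nonzero: "cmod z * cmod (b k) \<noteq> 1 \<Longrightarrow> 1 - b k * z \<noteq> 0"
  by (metis norm_mult norm_one right_minus_eq mult.commute)

private lemma g_nonzero: "cmod z * cmod (b n) < 1 \<Longrightarrow> g n z \<noteq> 0"
  using g_zero[of n z] by (auto simp: norm_mult mult.commute)

text \<open>The assumption excludes zeros of modulus |z|. It makes all linear factors nonzero, and
  the remaining cofactor \<open>g N\<close> is nonzero at z once N is large.\<close>

lemma f_nonzero:
  assumes "\<And>k. cmod z * cmod (b k) \<noteq> 1"
  shows "f z \<noteq> 0"
proof -
  obtain N where "cmod z * cmod (b N) < 1" using ex_small by blast
  then show ?thesis using assms linear_nonzero by (simp add: factor[of z N] g_nonzero)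
qed

text \<open>For large N, \<open>g N\<close> is zero-free on a disc beyond the circle, so summing the
  means of the N linear factors and of \<open>g N\<close> gives Jensen's formula exactly. Since its
  terms are nonnegative, only the first n need be kept; n = 0 gives the bare lower bound by ln
  |f(0)|.\<close>

lemma jensen_le:
  assumes r: "0 < r" "\<And>k. r * cmod (b k) \<noteq> 1"
  shows "2 * pi * (ln (cmod (f 0)) + (\<Sum>k<n. logp (r * cmod (b k))))
    \<le> integral {0..2*pi} (\<lambda>t. ln (cmod (f (of_real r * cis t))))"
proof -
  \<comment> \<open>The radius \<open>2 * r\<close> leaves room for an open disc containing the
    closed disc of radius r.\<close>
  obtain N where N: "N \<ge> n" "\<And>k. k \<ge> N \<Longrightarrow> 2 * r * cmod (b k) < 1" using ex_small[of n "2*r"] by auto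
  have gN: "g N z \<noteq> 0" if "z \<in> ball 0 (2 * r)" for z
  proof (rule g_nonzero)
    have "cmod z * cmod (b N) \<le> 2 * r * cmod (b N)" using that by (intro mult_right_mono) auto
    also have "\<dots> < 1" using N by simp
    finally show "cmod z * cmod (b N) < 1" .
  qed
  have "((\<lambda>t. ln (cmod (g N (of_real r * cis t)))) has_integral 2 * pi * ln (cmod (f 0))) {0..2*pi}"
    using has_integral_ln_cmod_nonvanishing[of "g N" "2 * r" r, OF _ gN] r g_hol[of N]
    by (auto simp: g_at_0 intro: holomorphic_on_subset)
  moreover have "((\<lambda>t. \<Sum>k<N. ln (cmod (1 - b k * (of_real r * cis t)))) has_integral
      (\<Sum>k<N. 2 * pi * logp (r * cmod (b k)))) {0..2*pi}"
    by (intro has_integral_sum has_integral_ln_cmod_linear r) auto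
  ultimately have "((\<lambda>t. ln (cmod (g N (of_real r * cis t))) +
        (\<Sum>k<N. ln (cmod (1 - b k * (of_real r * cis t))))) has_integral
      2 * pi * ln (cmod (f 0)) + (\<Sum>k<N. 2 * pi * logp (r * cmod (b k)))) {0..2*pi}"
    by (rule has_integral_add)
  moreover have "ln (cmod (g N z)) + (\<Sum>k<N. ln (cmod (1 - b k * z))) = ln (cmod (f z))"
    if "cmod z = r" for z
  proof -
    have nz: "1 - b k * z \<noteq> 0" for k using linear_nonzero[of z k] r that by simp
    have "g N z \<noteq> 0" using gN[of z] that r by simp
    then show ?thesis
      using nz by (simp add: factor[of z N] norm_mult prod_norm[symmetric] ln_mult ln_prod prod_pos)
  qed
  ultimately have "((\<lambda>t. ln (cmod (f (of_real r * cis t)))) has_integral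
      2 * pi * ln (cmod (f 0)) + (\<Sum>k<N. 2 * pi * logp (r * cmod (b k)))) {0..2*pi}"
    using r by (simp add: norm_mult)
  then have "integral {0..2*pi} (\<lambda>t. ln (cmod (f (of_real r * cis t)))) =
      2 * pi * (ln (cmod (f 0)) + (\<Sum>k<N. logp (r * cmod (b k))))"
    by (simp add: integral_unique sum_distrib_left distrib_left)
  moreover have "(\<Sum>k<n. logp (r * cmod (b k))) \<le> (\<Sum>k<N. logp (r * cmod (b k)))"
    using N by (intro sum_mono2) (auto simp: logp_nonneg)
  ultimately show ?thesis by simp
qed

section \<open>The genus zero product and the zero-free quotient\<close>

text \<open>The full product \<open>tail_prod 0\<close> vanishes at the zeros of f. Tails from every
  index are kept because, on a given disc, late tails are zero-free and can be divided by.\<close>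

definition tail_prod :: "nat \<Rightarrow> complex \<Rightarrow> complex" where
  "tail_prod n z = (\<Prod>k. 1 - b (k + n) * z)"

context
  assumes summable_b: "summable (\<lambda>k. cmod (b k))"
begin

lemma abs_convergent_tail: "abs_convergent_prod (\<lambda>k. 1 - b (k + n) * z)"
proof (rule summable_imp_abs_convergent_prod)
  show "summable (\<lambda>k. norm (1 - b (k + n) * z - 1))"
    using summable_mult2[OF summable_ignore_initial_segment[OF summable_b, of n], of "cmod z"]
    by (simp add: norm_mult)
qed

lemma convergent_tail: "convergent_prod (\<lambda>k. 1 - b (k + n) * z)"
  by (intro abs_convergent_prod_imp_convergent_prod abs_convergent_tail)

lemma tail_prod_step: "tail_prod n z = (1 - b n * z) * tail_prod (Suc n) z"
proof -
  have "(\<lambda>m. \<Prod>i\<le>Suc m. 1 - b (i + n) * z) \<longlonglongrightarrow> tail_prod n z"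
    using convergent_prod_LIMSEQ[OF convergent_tail[of n z]] unfolding tail_prod_def by (rule LIMSEQ_Suc)
  moreover have "(\<lambda>m. (1 - b n * z) * (\<Prod>i\<le>m. 1 - b (i + Suc n) * z)) \<longlonglongrightarrow> (1 - b n * z) * tail_prod (Suc n) z"
    using convergent_prod_LIMSEQ[OF convergent_tail[of "Suc n" z]] unfolding tail_prod_def by (rule tendsto_mult_left)
  ultimately show ?thesis
    by (simp only: prod.atMost_Suc_shift add_Suc_shift add_0) (rule LIMSEQ_unique)
qed

lemma tail_prod_nonzero:
  assumes "\<And>k. k \<ge> n \<Longrightarrow> cmod z * cmod (b k) < 1"
  shows "tail_prod n z \<noteq> 0"
proof -
  have "1 - b (i + n) * z \<noteq> 0" for i
    using linear_nonzero[of z "i + n"] assms[of "i + n"] by simp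
  then show ?thesis unfolding tail_prod_def by (intro prodinf_nonzero convergent_tail)
qed

text \<open>The Weierstrass M-test on the closed unit disc around each point makes the partial
  products converge locally uniformly.\<close>

lemma holomorphic_tail_prod: "tail_prod n holomorphic_on UNIV"
proof (rule holomorphic_uniform_sequence[where f = "\<lambda>N z. \<Prod>k<N. 1 - b (k + n) * z"])
  fix z :: complex
  have "uniformly_convergent_on (cball z 1) (\<lambda>N x. \<Sum>k<N. cmod (1 - b (k + n) * x - 1))"
  proof (rule Weierstrass_m_test')
    show "norm (cmod (1 - b (k + n) * x - 1)) \<le> cmod (b (k + n)) * (cmod z + 1)" if "x \<in> cball z 1" for k x
    proof -
      have "cmod x \<le> cmod z + 1" using that norm_triangle_sub[of x z] by (simp add: dist_norm norm_minus_commute)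
      then show ?thesis by (simp add: norm_mult mult_left_mono)
    qed
    show "summable (\<lambda>k. cmod (b (k + n)) * (cmod z + 1))"
      by (intro summable_mult2 summable_ignore_initial_segment summable_b)
  qed
  then have "uniformly_convergent_on (cball z 1) (\<lambda>N x. \<Prod>k<N. 1 - b (k + n) * x)"
    by (intro uniformly_convergent_on_prod') (auto intro!: continuous_intros)
  then have "uniform_limit (cball z 1) (\<lambda>N x. \<Prod>k<N. 1 - b (k + n) * x) (\<lambda>x. \<Prod>k. 1 - b (k + n) * x) sequentially"
    unfolding uniformly_convergent_uniform_limit_iff
    using limI[OF iffD2[OF LIMSEQ_lessThan_iff_atMost convergent_prod_LIMSEQ[OF convergent_tail]]]
    by simp
  then show "\<exists>d>0. cball z d \<subseteq> UNIV \<and>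
      uniform_limit (cball z d) (\<lambda>N x. \<Prod>k<N. 1 - b (k + n) * x) (tail_prod n) sequentially"
    unfolding tail_prod_def by (intro exI[of _ 1]) auto
qed (auto intro!: holomorphic_intros)

text \<open>The factor \<open>q\<close> is the product of 1 - b k z over n \<le> k < m. That the
  same \<open>q\<close> serves both functions makes g n / tail_prod n independent of n wherever the
  tails are nonzero.\<close>

lemma common_factor:
  assumes "n \<le> m"
  shows "\<exists>q. g n z = q * g m z \<and> tail_prod n z = q * tail_prod m z"
  using assms
proof (induction m rule: dec_induct)
  case base
  then show ?case by (intro exI[of _ 1]) simp
next
  case (step m)
  then show ?case using g_step[of m z] tail_prod_step[of m z] by (metis mult.assoc)
qed

text \<open>Formally H = f / \<open>tail_prod 0\<close>, but this is 0/0 at the zeros of f. Using g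
  n / tail_prod n with n past all zeros in the disc avoids this: numerator and denominator are
  zero-free there, and one n serves the whole disc, so H is holomorphic on it.\<close>

lemma quotient_by_product:
  obtains H where "H holomorphic_on UNIV" "\<And>z. H z \<noteq> 0" "\<And>z. f z = H z * tail_prod 0 z"
proof -
  \<comment> \<open>The chosen index may vary erratically with z; the next fact shows that every
    admissible index gives the same value.\<close>
  define H where "H z = (let n = (SOME n. \<forall>k\<ge>n. cmod z * cmod (b k) < 1) in g n z / tail_prod n z)" for z
  have H: "H z = g n z / tail_prod n z" if n: "\<And>k. k \<ge> n \<Longrightarrow> cmod z * cmod (b k) < 1" for n z
  proof -
    define m where "m = (SOME n. \<forall>k\<ge>n. cmod z * cmod (b k) < 1)"
    have "\<forall>k\<ge>m. cmod z * cmod (b k) < 1" unfolding m_def by (rule someI_ex) (use ex_small in blast)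
    then have "tail_prod m z \<noteq> 0" "tail_prod n z \<noteq> 0" using n by (simp_all add: tail_prod_nonzero)
    moreover have "g n z * tail_prod m z = g m z * tail_prod n z"
    proof (cases "n \<le> m")
      case True
      then obtain q where "g n z = q * g m z" "tail_prod n z = q * tail_prod m z" using common_factor by blast
      then show ?thesis by (simp only: ac_simps)
    next
      case False
      then obtain q where "g m z = q * g n z" "tail_prod m z = q * tail_prod n z"
        using common_factor[of m n z] by auto
      then show ?thesis by (simp only: ac_simps)
    qed
    ultimately show ?thesis unfolding H_def m_def[symmetric] Let_def by (simp add: frac_eq_eq)
  qed
  have "H z \<noteq> 0" "f z = H z * tail_prod 0 z" for z
  proof -
    obtain n where n: "\<And>k. k \<ge> n \<Longrightarrow> cmod z * cmod (b k) < 1" using ex_small by blast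
    have nz: "tail_prod n z \<noteq> 0" "g n z \<noteq> 0" using n tail_prod_nonzero g_nonzero by auto
    have Hz: "H z = g n z / tail_prod n z" by (rule H) (rule n)
    then show "H z \<noteq> 0" using nz by simp
    show "f z = H z * tail_prod 0 z"
    proof -
      obtain q where "f z = q * g n z" "tail_prod 0 z = q * tail_prod n z"
        using common_factor[of 0 n z] g_0 by auto
      then show ?thesis unfolding Hz using nz by simp
    qed
  qed
  moreover have "H holomorphic_on ball 0 R" for R
  proof -
    obtain n where n: "\<And>k. k \<ge> n \<Longrightarrow> R * cmod (b k) < 1" using ex_small by blast
    have small: "cmod z * cmod (b k) < 1" if "z \<in> ball 0 R" "k \<ge> n" for z k
    proof -
      have "cmod z * cmod (b k) \<le> R * cmod (b k)" using that by (intro mult_right_mono) auto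
      then show ?thesis using n[OF that(2)] by simp
    qed
    have "(\<lambda>z. g n z / tail_prod n z) holomorphic_on ball 0 R"
      using small by (intro holomorphic_intros tail_prod_nonzero holomorphic_on_subset[OF g_hol]
        holomorphic_on_subset[OF holomorphic_tail_prod]) auto
    then show ?thesis by (rule holomorphic_transform) (rule H[symmetric], use small in blast)
  qed
  then have "H field_differentiable at z" for z
    by (rule holomorphic_on_imp_differentiable_at[of _ "ball 0 (cmod z + 1)"]) auto
  then have "H holomorphic_on UNIV" by (simp add: holomorphic_on_def)
  ultimately show ?thesis using that by blast
qed

lemma cmod_tail_prod_le:
  assumes "\<And>n. (\<Sum>k<n. ln (1 + cmod z * cmod (b k))) \<le> B"
  shows "cmod (tail_prod 0 z) \<le> exp B"
proof (rule LIMSEQ_le_const2)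
  show "(\<lambda>n. cmod (\<Prod>i\<le>n. 1 - b i * z)) \<longlonglongrightarrow> cmod (tail_prod 0 z)"
    using convergent_prod_LIMSEQ[OF convergent_tail[of 0 z]] by (intro tendsto_norm) (simp add: tail_prod_def)
  have "cmod (\<Prod>i\<le>n. 1 - b i * z) \<le> exp B" for n
  proof -
    have "cmod (\<Prod>i\<le>n. 1 - b i * z) \<le> (\<Prod>i<Suc n. 1 + cmod z * cmod (b i))"
      unfolding prod_norm[symmetric] lessThan_Suc_atMost
      using norm_triangle_ineq4[of 1 "b _ * z"] by (intro prod_mono) (auto simp: norm_mult mult.commute)
    also have "\<dots> = exp (\<Sum>i<Suc n. ln (1 + cmod z * cmod (b i)))"
      unfolding exp_sum[OF finite_lessThan] by (intro prod.cong refl exp_ln[symmetric]) (simp add: add_pos_nonneg)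
    also have "\<dots> \<le> exp B" using assms[of "Suc n"] by simp
    finally show ?thesis .
  qed
  then show "\<exists>N. \<forall>n\<ge>N. cmod (\<Prod>i\<le>n. 1 - b i * z) \<le> exp B" by blast
qed

end

section \<open>Convergence and growth of the product from the Jensen bound\<close>

text \<open>At r = e/|b k| each of the first k + 1 terms is at least 1, so k + 1 \<le> T(r). A
  fourth-root bound on T then gives sqrt |b k| \<le> sqrt e / (k + 1)^2, a summable
  majorant.\<close>

lemma summable_sqrt_b:
  assumes T: "\<And>n r. 0 < r \<Longrightarrow> (\<Sum>k<n. logp (r * cmod (b k))) \<le> T r"
    and slow: "\<forall>\<^sub>F r in at_top. T r \<le> sqrt (sqrt r)"
  shows "summable (\<lambda>k. sqrt (cmod (b k)))"
proof (rule summable_comparison_test_ev)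
  obtain R where R: "\<And>r. r \<ge> R \<Longrightarrow> T r \<le> sqrt (sqrt r)" using slow by (auto simp: eventually_at_top_linorder)
  define R' where "R' = max R 1"
  have "(\<lambda>k. cmod (b k)) \<longlonglongrightarrow> 0" using b_lim by (simp add: tendsto_norm_zero)
  then have "\<forall>\<^sub>F k in sequentially. cmod (b k) < exp 1 / R'"
    by (rule order_tendstoD(2)) (simp add: R'_def)
  then show "\<forall>\<^sub>F k in sequentially. norm (sqrt (cmod (b k))) \<le> sqrt (exp 1) * (1 / (real (Suc k))^2)"
  proof eventually_elim
    case (elim k)
    show ?case
    proof (cases "b k = 0")
      case False
      define r where "r = exp 1 / cmod (b k)"
      have r: "r > 0" "r \<ge> R"
      proof -
        have "R' > 0" unfolding R'_def by simp
        then have "R' \<le> r" using False elim by (simp add: r_def field_simps)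
        then show "r > 0" "r \<ge> R" unfolding R'_def by simp_all
      qed
      have "logp (r * cmod (b i)) \<ge> 1" if "i < Suc k" for i
      proof -
        have "cmod (b k) \<le> cmod (b i)" using dec that by (auto simp: decseq_def)
        then have "r * cmod (b i) \<ge> exp 1" using False r(1) by (simp add: r_def field_simps)
        then have "logp (exp 1) \<le> logp (r * cmod (b i))" by (rule logp_mono)
        then show ?thesis by (simp add: logp_def)
      qed
      then have "real (Suc k) \<le> (\<Sum>i<Suc k. logp (r * cmod (b i)))"
        using sum_bounded_below[of "{..<Suc k}" 1 "\<lambda>i. logp (r * cmod (b i))"] by simp
      also have "\<dots> \<le> sqrt (sqrt r)" using T[OF r(1), of "Suc k"] R[OF r(2)] by simp
      finally have "(real (Suc k))^2 \<le> (sqrt (sqrt r))^2" by (intro power_mono) auto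
      also have "\<dots> = sqrt r" using r(1) by simp
      finally have "(real (Suc k))^2 \<le> sqrt (exp 1) / sqrt (cmod (b k))" by (simp add: r_def real_sqrt_divide)
      then show ?thesis using False by (simp add: field_simps)
    qed simp
  qed
  have "summable (\<lambda>k. 1 / (real (Suc k))^2)"
    using inverse_power_summable[of 2, where ?'a = real] by (subst summable_Suc_iff) (simp add: field_simps)
  then show "summable (\<lambda>k. sqrt (exp 1) * (1 / (real (Suc k))^2))" by (rule summable_mult)
qed

text \<open>This splits the logarithm of a factor into a term that Jensen's inequality controls at
  radius r^4 and a summable one independent of r. If r^2 x \<ge> 1 then 1 + r x \<le> r^4 x;
  otherwise r sqrt x \<le> 1, so ln (1 + r x) \<le> r x \<le> sqrt x.\<close>

lemma ln_linear_le:
  fixes r x :: real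
  assumes "r \<ge> 2" "x \<ge> 0"
  shows "ln (1 + r * x) \<le> logp (r ^ 4 * x) + sqrt x"
proof (cases "r^2 * x \<ge> 1")
  case True
  have "2 * 2 \<le> r * r" using assms by (intro mult_mono) auto
  then have "r * r \<ge> 4" by simp
  have "r ^ 4 * x = r^2 * (r^2 * x)" by (simp add: power2_eq_square power4_eq_xxxx)
  also have "\<dots> \<ge> 4 * (r^2 * x)"
    using \<open>r * r \<ge> 4\<close> True by (intro mult_right_mono) (auto simp: power2_eq_square)
  finally have 1: "4 * (r^2 * x) \<le> r ^ 4 * x" .
  have "r * x * 2 \<le> r * x * r" using assms by (intro mult_left_mono) auto
  then have "1 + r * x \<le> r ^ 4 * x" using 1 True by (simp add: power2_eq_square ac_simps)
  then have "logp (1 + r * x) \<le> logp (r ^ 4 * x)" by (rule logp_mono)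
  moreover have "logp (1 + r * x) = ln (1 + r * x)" using assms unfolding logp_eq_ln_max by (simp add: max_def)
  moreover have "0 \<le> sqrt x" using assms by simp
  ultimately show ?thesis by linarith
next
  case False
  have "sqrt (r^2 * x) \<le> 1" using False by simp
  then have "r * sqrt x \<le> 1" using assms by (simp add: real_sqrt_mult)
  then have "r * sqrt x * sqrt x \<le> 1 * sqrt x" using assms by (intro mult_right_mono) auto
  then have "r * x \<le> sqrt x" using assms by (simp add: mult.assoc)
  moreover have "ln (1 + r * x) \<le> r * x" using assms by (intro ln_add_one_self_le_self) auto
  ultimately show ?thesis using logp_nonneg[of "r^4 * x"] by linarith
qed

lemma sum_ln_le:
  assumes T: "\<And>n r. 0 < r \<Longrightarrow> (\<Sum>k<n. logp (r * cmod (b k))) \<le> T r"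
    and sm: "summable (\<lambda>k. sqrt (cmod (b k)))" and r: "r \<ge> 2"
  shows "(\<Sum>k<n. ln (1 + r * cmod (b k))) \<le> T (r ^ 4) + (\<Sum>k. sqrt (cmod (b k)))"
proof -
  have "(\<Sum>k<n. ln (1 + r * cmod (b k))) \<le> (\<Sum>k<n. logp (r ^ 4 * cmod (b k)) + sqrt (cmod (b k)))"
    by (intro sum_mono ln_linear_le r) auto
  also have "\<dots> = (\<Sum>k<n. logp (r ^ 4 * cmod (b k))) + (\<Sum>k<n. sqrt (cmod (b k)))"
    by (rule sum.distrib)
  also have "\<dots> \<le> T (r ^ 4) + (\<Sum>k. sqrt (cmod (b k)))"
    using T[of "r ^ 4" n] r sm by (intro add_mono sum_le_suminf) auto
  finally show ?thesis .
qed

lemma summable_b_if_sqrt: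
  assumes "summable (\<lambda>k. sqrt (cmod (b k)))"
  shows "summable (\<lambda>k. cmod (b k))"
proof (rule summable_comparison_test_ev[OF _ assms])
  have "(\<lambda>k. cmod (b k)) \<longlonglongrightarrow> 0" using b_lim by (simp add: tendsto_norm_zero)
  then have "\<forall>\<^sub>F k in sequentially. cmod (b k) < 1" by (rule order_tendstoD(2)) simp
  then show "\<forall>\<^sub>F k in sequentially. norm (cmod (b k)) \<le> sqrt (cmod (b k))"
  proof eventually_elim
    case (elim k)
    then have "sqrt (cmod (b k)) * sqrt (cmod (b k)) \<le> 1 * sqrt (cmod (b k))"
      by (intro mult_right_mono) auto
    then show ?case by simp
  qed
qed

end

section \<open>Exceptional radii and the norm of the curve\<close>

lemma continuous_on_circle_integral:
  fixes u :: "complex \<Rightarrow> real"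
  assumes "continuous_on UNIV u"
  shows "continuous_on UNIV (\<lambda>r. integral {0..2*pi} (\<lambda>t. u (of_real r * cis t)))"
proof -
  have "continuous_on (UNIV \<times> cbox 0 (2*pi)) (\<lambda>(r, t). u (of_real r * cis t))"
    unfolding split_beta
    by (rule continuous_on_compose2[OF assms]) (auto intro!: continuous_intros)
  from integral_continuous_on_param[OF this] show ?thesis by simp
qed

text \<open>The points where the inequality fails form an open set, and a nonempty open set of reals
  is uncountable. This extends estimates from circles free of zeros to all circles, so that singular
  integrals of ln |f| never have to be treated.\<close>

lemma le_if_le_off_countable:
  fixes u v :: "real \<Rightarrow> real"
  assumes "continuous_on UNIV u" "continuous_on UNIV v" "countable C"
    and le: "\<And>x. a < x \<Longrightarrow> x \<notin> C \<Longrightarrow> u x \<le> v x" and "a < x"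
  shows "u x \<le> v x"
proof (rule ccontr)
  assume "\<not> u x \<le> v x"
  define U where "U = {x. v x < u x} \<inter> {a<..}"
  have "open U" unfolding U_def by (intro open_Int open_Collect_less assms open_greaterThan)
  moreover have "x \<in> U" using \<open>\<not> u x \<le> v x\<close> \<open>a < x\<close> by (simp add: U_def)
  ultimately obtain e where "e > 0" "ball x e \<subseteq> U" by (meson open_contains_ball)
  moreover have "U \<subseteq> C" using le by (force simp: U_def)
  ultimately have "countable (ball x e)" using \<open>countable C\<close> by (meson countable_subset subset_trans)
  then show False using uncountable_ball[OF \<open>e > 0\<close>, of x] by simp
qed

lemma curve_norm_ge: "i \<le> n \<Longrightarrow> cmod (F i z) \<le> curve_norm n F z"
  unfolding curve_norm_def by (rule Max_ge) auto

lemma curve_norm_pos: "reduced_rep n F \<Longrightarrow> 0 < curve_norm n F z"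
  unfolding reduced_rep_def by (meson curve_norm_ge less_le_trans zero_less_norm_iff)

lemma continuous_on_curve_norm:
  assumes "\<And>i. i \<le> n \<Longrightarrow> continuous_on S (F i)"
  shows "continuous_on S (curve_norm n F)"
  using assms
proof (induction n)
  case 0
  then show ?case by (auto simp: curve_norm_def intro!: continuous_intros)
next
  case (Suc n)
  have "curve_norm (Suc n) F = (\<lambda>z. max (cmod (F (Suc n) z)) (curve_norm n F z))"
    by (simp add: curve_norm_def fun_eq_iff atLeast0_atMost_Suc)
  then show ?case using Suc by (auto intro!: continuous_intros)
qed

lemma continuous_on_ln_curve_norm:
  assumes "reduced_rep n F"
  shows "continuous_on UNIV (\<lambda>z. ln (curve_norm n F z))"
proof -
  have "continuous_on UNIV (curve_norm n F)"
    using assms by (intro continuous_on_curve_norm)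
      (auto simp: reduced_rep_def holomorphic_on_imp_continuous_on)
  then show ?thesis using curve_norm_pos[OF assms]
    by (intro continuous_on_ln) (auto simp: less_le)
qed

section \<open>Translating iterated logarithms into growth bounds\<close>

text \<open>Exponentiating twice turns the ratio bound into T(r) \<le> exp ((ln r)^\<tau>). With
  \<open>1 < ln r\<close> the power is at least 1, which also covers the cases where a logarithm is
  truncated.\<close>

lemma iterated_log_less_imp_le:
  assumes "1 < ln r" "0 < \<tau>" "logp (logp x) / ln (ln r) < \<tau>"
  shows "x \<le> exp (ln r powr \<tau>)"
proof -
  have L: "0 < ln (ln r)" using assms by simp
  have A1: "1 \<le> ln r powr \<tau>" using assms by (intro ge_one_powr_ge_zero) auto
  have "logp x \<le> ln r powr \<tau>"
  proof (cases "logp x \<le> 1")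
    case False
    then have "ln (logp x) < \<tau> * ln (ln r)" using assms L by (simp add: logp_def[of "logp x"] field_simps)
    also have "\<dots> = ln (ln r powr \<tau>)" using assms by (simp add: ln_powr)
    finally have "logp x < ln r powr \<tau>" using False A1 by (subst (asm) ln_less_cancel_iff) auto
    then show ?thesis by simp
  qed (use A1 in simp)
  then show ?thesis
  proof (cases "x \<le> 1")
    case True
    have "1 \<le> exp (ln r powr \<tau>)" by simp
    then show ?thesis using True by linarith
  next
    case False
    then show ?thesis using \<open>logp x \<le> ln r powr \<tau>\<close> by (simp add: logp_def ln_le_cancel_iff[symmetric] del: ln_le_cancel_iff)
  qed
qed

lemma iterated_log_le:
  assumes "1 < ln r" "0 < \<tau>" "x \<le> exp (ln r powr \<tau>)"
  shows "logp (logp x) / ln (ln r) \<le> \<tau>"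
proof -
  have L: "0 < ln (ln r)" using assms by simp
  have A1: "1 \<le> ln r powr \<tau>" using assms by (intro ge_one_powr_ge_zero) auto
  have "logp x \<le> logp (exp (ln r powr \<tau>))" by (rule logp_mono) fact
  also have "\<dots> = ln r powr \<tau>" using A1 by (simp add: logp_eq_ln_max max_def)
  finally have "logp (logp x) \<le> logp (ln r powr \<tau>)" by (rule logp_mono)
  also have "\<dots> = ln (ln r powr \<tau>)" using A1 by (simp add: logp_eq_ln_max max_def)
  also have "\<dots> = \<tau> * ln (ln r)" using assms by (simp add: ln_powr)
  finally show ?thesis using L by (simp add: field_simps)
qed

lemma Limsup_iterated_log_less_1E:
  assumes "Limsup at_top (\<lambda>r. ereal (logp (logp (T r)) / ln (ln r))) < 1"
  obtains \<tau> where "0 < \<tau>" "\<tau> < 1" "\<forall>\<^sub>F r in at_top. T r \<le> exp (ln r powr \<tau>)"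
proof -
  let ?L = "Limsup at_top (\<lambda>r. ereal (logp (logp (T r)) / ln (ln r)))"
  \<comment> \<open>The maximum with 0 makes the exponent \<tau> chosen next positive.\<close>
  have "max ?L 0 < 1" using assms by simp
  then obtain \<tau> where \<tau>: "max ?L 0 < ereal \<tau>" "ereal \<tau> < 1" using ereal_dense2 by blast
  then have "\<forall>\<^sub>F r in at_top. ereal (logp (logp (T r)) / ln (ln r)) < ereal \<tau>"
    by (intro Limsup_lessD) simp
  moreover have "\<forall>\<^sub>F r::real in at_top. 1 < ln r" by real_asymp
  ultimately have "\<forall>\<^sub>F r in at_top. T r \<le> exp (ln r powr \<tau>)"
  proof eventually_elim
    case (elim r)
    then show ?case using \<tau> by (intro iterated_log_less_imp_le) auto
  qed
  then show ?thesis using that[of \<tau>] \<tau> by simp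
qed

lemma Limsup_iterated_log_less_1I:
  assumes "0 < \<tau>" "\<tau> < 1" and "\<forall>\<^sub>F r in at_top. T r \<le> exp (ln r powr \<tau>)"
  shows "Limsup at_top (\<lambda>r. ereal (logp (logp (T r)) / ln (ln r))) < 1"
proof -
  have "\<forall>\<^sub>F r::real in at_top. 1 < ln r" by real_asymp
  with assms(3) have "\<forall>\<^sub>F r in at_top. ereal (logp (logp (T r)) / ln (ln r)) \<le> ereal \<tau>"
  proof eventually_elim
    case (elim r)
    then show ?case using assms iterated_log_le by auto
  qed
  then have "Limsup at_top (\<lambda>r. ereal (logp (logp (T r)) / ln (ln r))) \<le> ereal \<tau>" by (rule Limsup_bounded)
  then show ?thesis using assms(2) by (metis ereal_less(3) le_less_trans less_ereal.simps(1) one_ereal_def)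
qed

text \<open>For \<tau> < 1 the power (ln r)^\<tau> is o(ln r), so its exponential stays below every
  positive power of r.\<close>

lemma growth_lt_fourth_root:
  fixes \<tau> c :: real
  assumes "0 < \<tau>" "\<tau> < 1"
  shows "\<forall>\<^sub>F r in at_top. exp (ln r powr \<tau>) + c \<le> sqrt (sqrt r)"
  using assms by real_asymp

text \<open>Passing from r to r^4 only multiplies (ln r)^\<tau> by 4^\<tau>, and any larger exponent
  absorbs a constant factor.\<close>

lemma growth_sum:
  fixes \<tau> c :: real
  assumes "0 < \<tau>" "\<tau> < \<tau>'"
  shows "\<forall>\<^sub>F r in at_top. exp (ln r powr \<tau>) + exp (ln (r ^ 4) powr \<tau>) + c \<le> exp (ln r powr \<tau>')"
proof -
  \<comment> \<open>Here x stands for ln r. All three summands are at most multiples of the middle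
    exponential, with total factor 2 + |c|, which becomes an additive logarithm.\<close>
  have "\<forall>\<^sub>F x in at_top. 4 powr \<tau> * x powr \<tau> + ln (2 + \<bar>c\<bar>) \<le> x powr \<tau>'"
    using assms by real_asymp
  then have "\<forall>\<^sub>F r in at_top. 4 powr \<tau> * ln r powr \<tau> + ln (2 + \<bar>c\<bar>) \<le> ln r powr \<tau>'"
    using ln_at_top by (rule eventually_compose_filterlim)
  moreover have "\<forall>\<^sub>F r::real in at_top. 1 < r" by (rule eventually_gt_at_top)
  ultimately show ?thesis
  proof eventually_elim
    case (elim r)
    define A where "A = (4 * ln r) powr \<tau>"
    have "exp (ln (r ^ 4) powr \<tau>) = exp A" using elim by (simp add: A_def ln_realpow)
    moreover have "exp (ln r powr \<tau>) \<le> exp A"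
      unfolding A_def exp_le_cancel_iff using elim assms by (intro powr_mono2) auto
    moreover have "c \<le> \<bar>c\<bar> * exp A"
      using mult_left_mono[of 1 "exp A" "\<bar>c\<bar>"] by (simp add: A_def)
    ultimately have "exp (ln r powr \<tau>) + exp (ln (r ^ 4) powr \<tau>) + c \<le> exp A + exp A + \<bar>c\<bar> * exp A"
      by linarith
    also have "\<dots> = (2 + \<bar>c\<bar>) * exp A" by (simp add: algebra_simps)
    also have "\<dots> = exp (A + ln (2 + \<bar>c\<bar>))" by (simp add: exp_add)
    also have "\<dots> \<le> exp (ln r powr \<tau>')"
      using elim by (simp add: A_def powr_mult)
    finally show ?case .
  qed
qed

section \<open>Construction of the representation and the characteristic estimate\<close>

theorem theorem3p5:
  fixes n :: nat and F :: "nat \<Rightarrow> complex \<Rightarrow> complex"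
  assumes "reduced_rep n F"
    and "Limsup at_top (\<lambda>r. ereal (logp (logp (char_curve n F r)) / ln (ln r))) < 1"
  shows "\<exists>G. reduced_rep n G \<and> same_curve n G F \<and> (\<forall>i\<le>n. sigma2_log (G i) < 1)"
proof -
  have holF: "F i holomorphic_on UNIV" if "i \<le> n" for i using assms(1) that by (simp add: reduced_rep_def)
  obtain j where j: "j \<le> n" "F j 0 \<noteq> 0" using assms(1) by (auto simp: reduced_rep_def)
  define f where "f = F j"
  have "f holomorphic_on UNIV" "f 0 \<noteq> 0" using j holF by (auto simp: f_def)
  then obtain b g where zeros: "successive_zeros f b g" by (rule entire_successive_zeros)
  \<comment> \<open>These are the moduli of the zeros of f, together with 0 if some
    \<open>b k\<close> is 0. On circles with positive radius outside C, ln |f| is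
    continuous.\<close>
  define C where "C = (\<lambda>k. 1 / cmod (b k)) ` UNIV"
  have "countable C" unfolding C_def by simp
  have generic: "r * cmod (b k) \<noteq> 1" if "r \<notin> C" for r k
  proof
    assume "r * cmod (b k) = 1"
    then have "r = 1 / cmod (b k)" by (cases "b k = 0") (auto simp: field_simps)
    then show False using that by (auto simp: C_def)
  qed
  define u where "u = (\<lambda>z. ln (curve_norm n F z))"
  have contu: "continuous_on UNIV u" unfolding u_def by (rule continuous_on_ln_curve_norm) fact
  have char: "char_curve n F = (\<lambda>r. integral {0..2*pi} (\<lambda>t. u (of_real r * cis t)) / (2*pi))"
    unfolding u_def char_curve_def ..
  have cont_char: "continuous_on UNIV (char_curve n F)"
    unfolding char by (intro continuous_intros continuous_on_circle_integral contu) auto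
  have circle: "(\<lambda>t. v (of_real r * cis t)) integrable_on {0..2*pi}"
    if "continuous_on (sphere 0 r) v" "r > 0" for v :: "complex \<Rightarrow> real" and r
    by (intro integrable_continuous_interval continuous_on_compose2[OF that(1)])
      (use that(2) in \<open>auto intro!: continuous_intros simp: norm_mult\<close>)
  have int_ln_f: "(\<lambda>t. ln (cmod (f (of_real r * cis t)))) integrable_on {0..2*pi}"
    if "r > 0" "r \<notin> C" for r
  proof (rule circle)
    have "continuous_on (sphere 0 r) f"
      using \<open>f holomorphic_on UNIV\<close> holomorphic_on_imp_continuous_on holomorphic_on_subset by blast
    then show "continuous_on (sphere 0 r) (\<lambda>z. ln (cmod (f z)))"
      using f_nonzero[OF zeros] generic[OF that(2)] by (intro continuous_on_ln continuous_on_norm) auto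
  qed fact
  have int_u: "(\<lambda>t. u (of_real r * cis t)) integrable_on {0..2*pi}" if "r > 0" for r
    using circle[OF continuous_on_subset[OF contu]] that by simp
  \<comment> \<open>Jensen's constant is absorbed here, so that T bounds the zero sums with no
    further error term.\<close>
  define T where "T r = char_curve n F r - ln (cmod (f 0))" for r
  have T: "(\<Sum>k<m. logp (r * cmod (b k))) \<le> T r" if "0 < r" for m r
  proof (rule le_if_le_off_countable[OF _ _ \<open>countable C\<close> _ that])
    fix r :: real assume r: "0 < r" "r \<notin> C"
    have "2 * pi * (ln (cmod (f 0)) + (\<Sum>k<m. logp (r * cmod (b k))))
        \<le> integral {0..2*pi} (\<lambda>t. ln (cmod (f (of_real r * cis t))))"
      by (rule jensen_le[OF zeros]) (use r generic in auto)
    also have "\<dots> \<le> integral {0..2*pi} (\<lambda>t. u (of_real r * cis t))"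
    proof (rule integral_le[OF int_ln_f int_u])
      fix t
      have "f (of_real r * cis t) \<noteq> 0" using f_nonzero[OF zeros] generic[OF r(2)] r(1) by (simp add: norm_mult)
      then show "ln (cmod (f (of_real r * cis t))) \<le> u (of_real r * cis t)"
        unfolding u_def f_def using curve_norm_ge[OF j(1), of F] by (intro ln_mono) auto
    qed (use r in auto)
    also have "\<dots> = 2 * pi * char_curve n F r" by (simp add: char)
    finally show "(\<Sum>k<m. logp (r * cmod (b k))) \<le> T r" by (simp add: T_def)
  qed (auto simp: T_def intro!: continuous_intros cont_char)
  obtain \<tau> where \<tau>: "0 < \<tau>" "\<tau> < 1" and growth: "\<forall>\<^sub>F r in at_top. char_curve n F r \<le> exp (ln r powr \<tau>)"
    using assms(2) by (rule Limsup_iterated_log_less_1E)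
  have "\<forall>\<^sub>F r in at_top. T r \<le> sqrt (sqrt r)"
    using growth growth_lt_fourth_root[OF \<tau>, of "- ln (cmod (f 0))"]
    by eventually_elim (simp add: T_def)
  with T have sm: "summable (\<lambda>k. sqrt (cmod (b k)))" by (rule summable_sqrt_b[OF zeros])
  note smb = summable_b_if_sqrt[OF zeros sm]
  obtain H where H: "H holomorphic_on UNIV" "\<And>z. H z \<noteq> 0" "\<And>z. f z = H z * tail_prod b 0 z"
    by (rule quotient_by_product[OF zeros smb]) (rule that; blast)
  define G where "G i z = F i z / H z" for i z
  define D where "D = (\<Sum>k. sqrt (cmod (b k)))"
  have holG: "G i holomorphic_on UNIV" if "i \<le> n" for i
    unfolding G_def by (intro holomorphic_on_divide holF H that)
  have "reduced_rep n G"
    using assms(1) holG H(2) by (auto simp: reduced_rep_def G_def)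
  moreover have "same_curve n G F"
    unfolding same_curve_def
  proof
    fix z
    show "\<exists>c. c \<noteq> 0 \<and> (\<forall>i\<le>n. G i z = c * F i z)"
      using H(2)[of z] by (intro exI[of _ "1 / H z"]) (simp add: G_def)
  qed
  moreover have "sigma2_log (G i) < 1" if i: "i \<le> n" for i
  proof -
    have contG: "continuous_on UNIV (\<lambda>z. logp (cmod (G i z)))"
      by (intro continuous_intros holomorphic_on_imp_continuous_on holG i)
    define N where "N r = integral {0..2*pi} (\<lambda>t. logp (cmod (G i (of_real r * cis t)))) / (2*pi)" for r
    have N: "nev_char_entire (G i) = N" by (simp add: nev_char_entire_def N_def fun_eq_iff)
    have bound: "N r \<le> T r + (T (r ^ 4) + D)" if "2 < r" for r
    proof (rule le_if_le_off_countable[OF _ _ \<open>countable C\<close> _ that])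
      show "continuous_on UNIV N"
        unfolding N_def by (intro continuous_intros continuous_on_circle_integral[OF contG]) auto
      show "continuous_on UNIV (\<lambda>r. T r + (T (r ^ 4) + D))"
        unfolding T_def by (intro continuous_intros continuous_on_compose2[OF cont_char]) auto
      fix r :: real assume r: "2 < r" "r \<notin> C"
      define V where "V = T (r ^ 4) + D"
      \<comment> \<open>The empty zero sum already shows that \<open>T (r ^ 4)\<close> is
        nonnegative.\<close>
      have "0 \<le> V" using T[of "r ^ 4" 0] suminf_nonneg[OF sm] r by (simp add: V_def D_def)
      have pointwise: "logp (cmod (G i z)) \<le> u z - ln (cmod (f z)) + V" if z: "cmod z = r" for z
      proof -
        have fz: "f z \<noteq> 0" using f_nonzero[OF zeros, of z] generic[OF r(2)] z by simp
        \<comment> \<open>This majorant of |G i| is at least 1, so its truncated logarithm is the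
          ordinary one and splits into terms that can be integrated separately.\<close>
        define X where "X = curve_norm n F z / cmod (f z) * exp V"
        have "cmod (f z) \<le> curve_norm n F z" unfolding f_def by (rule curve_norm_ge[OF j(1)])
        then have ge1: "1 \<le> curve_norm n F z / cmod (f z)" using fz by simp
        then have "1 * 1 \<le> X" unfolding X_def using \<open>0 \<le> V\<close> by (intro mult_mono) auto
        have "(\<Sum>k<m. ln (1 + cmod z * cmod (b k))) \<le> V" for m
          unfolding V_def D_def z by (rule sum_ln_le[OF zeros T sm]) (use r in auto)
        then have "cmod (tail_prod b 0 z) \<le> exp V" by (rule cmod_tail_prod_le[OF zeros smb])
        have "cmod (G i z) = cmod (F i z) / cmod (f z) * cmod (tail_prod b 0 z)"
          using H(2)[of z] H(3)[of z] fz by (auto simp: G_def norm_divide norm_mult)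
        also have "\<dots> \<le> X"
          unfolding X_def using curve_norm_ge[OF i, of F z] \<open>cmod (tail_prod b 0 z) \<le> exp V\<close> ge1
          by (intro mult_mono divide_right_mono) auto
        finally have "logp (cmod (G i z)) \<le> logp X" by (rule logp_mono)
        also have "logp X = ln X" using \<open>1 * 1 \<le> X\<close> by (simp add: logp_eq_ln_max max_def)
        also have "\<dots> = u z - ln (cmod (f z)) + V"
          unfolding X_def u_def using fz curve_norm_pos[OF assms(1), of z] by (simp add: ln_mult ln_div)
        finally show ?thesis .
      qed
      have "((\<lambda>t. logp (cmod (G i (of_real r * cis t)))) has_integral 2 * pi * N r) {0..2*pi}"
        using integrable_integral[OF circle[OF continuous_on_subset[OF contG]], of r] r by (simp add: N_def)
      moreover have "((\<lambda>t. u (of_real r * cis t) - ln (cmod (f (of_real r * cis t))) + V) has_integral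
          integral {0..2*pi} (\<lambda>t. u (of_real r * cis t))
          - integral {0..2*pi} (\<lambda>t. ln (cmod (f (of_real r * cis t)))) + (2*pi - 0) *\<^sub>R V) {0..2*pi}"
        by (intro has_integral_add has_integral_diff integrable_integral int_u int_ln_f)
          (use r has_integral_const_real[of V 0 "2 * pi"] in auto)
      ultimately have "2 * pi * N r \<le> integral {0..2*pi} (\<lambda>t. u (of_real r * cis t))
          - integral {0..2*pi} (\<lambda>t. ln (cmod (f (of_real r * cis t)))) + (2*pi - 0) *\<^sub>R V"
        by (rule has_integral_le) (use r pointwise in \<open>simp add: norm_mult\<close>)
      also have "\<dots> \<le> 2 * pi * char_curve n F r - 2 * pi * ln (cmod (f 0)) + 2 * pi * V"
        \<comment> \<open>Jensen's inequality with no zeros counted bounds the mean of ln |f| below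
          by ln |f(0)|.\<close>
        using jensen_le[OF zeros, of r 0] r generic by (simp add: char)
      also have "\<dots> = 2 * pi * (T r + V)" by (simp add: T_def algebra_simps)
      finally show "N r \<le> T r + (T (r ^ 4) + D)" by (simp add: V_def)
    qed
    \<comment> \<open>An exponent strictly between \<tau> and 1 leaves room to absorb the radius r^4
      and the constants.\<close>
    have \<tau>': "\<tau> < (\<tau> + 1) / 2" "(\<tau> + 1) / 2 < 1" using \<tau> by auto
    from bound have "\<forall>\<^sub>F r in at_top. N r \<le> T r + (T (r ^ 4) + D)"
      by (auto simp: eventually_at_top_dense)
    moreover have "\<forall>\<^sub>F r in at_top. char_curve n F (r ^ 4) \<le> exp (ln (r ^ 4) powr \<tau>)"
      using growth by (rule eventually_compose_filterlim) real_asymp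
    ultimately have "\<forall>\<^sub>F r in at_top. N r \<le> exp (ln r powr ((\<tau> + 1) / 2))"
      using growth growth_sum[OF \<tau>(1) \<tau>'(1), of "D - 2 * ln (cmod (f 0))"]
      by eventually_elim (simp add: T_def)
    then show ?thesis
      unfolding sigma2_log_def N using \<tau> \<tau>' by (intro Limsup_iterated_log_less_1I) auto
  qed
  ultimately show ?thesis by blast
qed

thm_deps theorem3p5

end
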